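(* Let $m,\ell$ be coprime integers with $\ell>m$ and $\ell\neq-m$, let $c_1,c_2$ be nonzero real numbers, and let $f(t)=c_1e^{itm}+c_2e^{it\ell}$, $t\in\mathbb{R}$. Suppose that $mc_1=\ell c_2$. Then the set of the local singular points of the curve $f$ coincides with the set of points $w_k=f(t_k)$, where $$t_k=\frac{2k+1}{\ell-m}\pi \pmod{2\pi},\qquad 0\le k\le \ell-m-1 .$$
   Context: Write $f=\phi+i\psi$ with $\phi,\psi$ real-valued. The local singular points of the curve $x=\phi(t)$, $y=\psi(t)$ are those points where $\dot\phi(t)=\dot\psi(t)=0$. *)

theory Defs
  imports Complex_Main
begin

text \<open>
  With \<open>f = \<phi> + \<i>\<psi>\<close>, the local singular points are points of the plane, namely the
  values \<open>f t\<close> at those parameters \<open>t\<close> where both derivatives exist and vanish.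
\<close>

definition local_singular_points :: "(real \<Rightarrow> complex) \<Rightarrow> complex set" where
  "local_singular_points f =
    {f t | t. ((\<lambda>s. Re (f s)) has_real_derivative 0) (at t) \<and>
              ((\<lambda>s. Im (f s)) has_real_derivative 0) (at t)}"

end

theory Submission
  imports Defs "HOL-Analysis.Complex_Transcendental"
begin

text \<open>
  Because \<open>m c1 = l c2\<close>, the two exponentials enter the velocity with the same weight:
  \<open>f'(t) = \<i> m c1 (cis (t m) + cis (t l))\<close>. That weight is nonzero, so a singular
  parameter is one at which the two rotating unit vectors are opposite. This depends only
  on the angle \<open>t (l - m)\<close> between them, which has to be an odd multiple of \<open>\<pi>\<close>. The
  parameters found this way form an infinite arithmetic progression with step
  \<open>2 \<pi> / (l - m)\<close>; since \<open>f\<close> has period \<open>2 \<pi>\<close>, any \<open>l - m\<close> consecutive ones already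
  give all the singular points.
\<close>

text \<open>
  Two equations amount to one because together they say that the squared length of
  \<open>cis a + cis b\<close> vanishes, and this length depends only on \<open>b - a\<close>.
\<close>

lemma unit_vectors_cancel_iff:
  fixes a b :: real
  shows "sin a + sin b = 0 \<and> cos a + cos b = 0 \<longleftrightarrow> cos (b - a) = -1"
proof -
  have "(sin a + sin b)\<^sup>2 + (cos a + cos b)\<^sup>2 = 2 + 2 * cos (b - a)"
    by (simp add: cos_diff power2_sum sin_squared_eq)
  then show ?thesis by (smt (verit) sum_power2_eq_zero_iff)
qed

lemma has_real_derivative_0_iff:
  assumes "(g has_real_derivative D) (at t)"
  shows "(g has_real_derivative 0) (at t) \<longleftrightarrow> D = 0"
  using assms DERIV_unique by blast

theorem theorem7p3:
  fixes m l :: int and c1 c2 :: real and f :: "real \<Rightarrow> complex" and \<tau> :: "int \<Rightarrow> real"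
  assumes "coprime m l" and "l > m" and "l \<noteq> - m"
    and "c1 \<noteq> 0" and "c2 \<noteq> 0"
    and f: "\<And>t. f t = complex_of_real c1 * exp (\<i> * complex_of_real t * of_int m)
                    + complex_of_real c2 * exp (\<i> * complex_of_real t * of_int l)"
    and "of_int m * c1 = of_int l * c2"
    and \<tau>: "\<And>k. \<tau> k = of_int (2 * k + 1) / of_int (l - m) * pi"
  shows "local_singular_points f = {f (\<tau> k) | k. 0 \<le> k \<and> k \<le> l - m - 1}"
proof -
  define w where "w = of_int m * c1"
  \<comment> \<open>If \<open>m = 0\<close>, then \<open>l c2 = 0\<close> would force \<open>l = 0 = m\<close>.\<close>
  have "m \<noteq> 0" using assms(2,5,7) by auto
  then have w: "w \<noteq> 0" using \<open>c1 \<noteq> 0\<close> by (simp add: w_def)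
  have w_l: "of_int l * c2 = w" using assms(7) by (simp add: w_def)
  have f_cis: "f t = of_real c1 * cis (t * of_int m) + of_real c2 * cis (t * of_int l)" for t
    by (simp add: f cis_conv_exp mult.assoc)

  have w_distrib: "w * (x + y) = of_int m * c1 * x + of_int l * c2 * y" for x y
    by (simp add: w_l distrib_left flip: w_def)
  have Re_deriv: "((\<lambda>s. Re (f s)) has_real_derivative
      - (w * (sin (t * of_int m) + sin (t * of_int l)))) (at t)" for t
    unfolding f_cis w_distrib
    by (auto intro!: derivative_eq_intros simp: algebra_simps)
  have Im_deriv: "((\<lambda>s. Im (f s)) has_real_derivative
      w * (cos (t * of_int m) + cos (t * of_int l))) (at t)" for t
    unfolding f_cis w_distrib
    by (auto intro!: derivative_eq_intros simp: algebra_simps)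
  have singular_iff: "((\<lambda>s. Re (f s)) has_real_derivative 0) (at t) \<and>
        ((\<lambda>s. Im (f s)) has_real_derivative 0) (at t) \<longleftrightarrow> (\<exists>n. t = \<tau> n)" for t
  proof -
    have "((\<lambda>s. Re (f s)) has_real_derivative 0) (at t) \<and>
          ((\<lambda>s. Im (f s)) has_real_derivative 0) (at t) \<longleftrightarrow>
          cos (t * of_int l - t * of_int m) = -1"
      using w unit_vectors_cancel_iff[of "t * of_int m" "t * of_int l"]
      by (simp add: has_real_derivative_0_iff[OF Re_deriv] has_real_derivative_0_iff[OF Im_deriv])
    also have "\<dots> \<longleftrightarrow> (\<exists>n. t = \<tau> n)"
      unfolding cos_eq_minus1 \<tau> using \<open>l > m\<close>
      by (intro ex_cong1) (simp add: field_simps)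
    finally show ?thesis .
  qed

  have period: "f (t + 2 * pi * of_int q) = f t" for t and q :: int
  proof -
    have "cis ((t + 2 * pi * of_int q) * of_int j) = cis (t * of_int j)" for j :: int
    proof -
      have "cis ((t + 2 * pi * of_int q) * of_int j)
              = cis (t * of_int j) * cis (2 * pi * of_int (q * j))"
        by (simp add: cis_mult algebra_simps)
      then show ?thesis by (simp add: cis_multiple_2pi del: of_int_mult)
    qed
    then show ?thesis by (simp add: f_cis)
  qed
  have reduce: "f (\<tau> n) = f (\<tau> (n mod (l - m)))" for n
  proof -
    have "\<tau> (q * (l - m) + r) = \<tau> r + 2 * pi * of_int q" for q r
      using \<open>l > m\<close> by (simp add: \<tau> field_simps)
    from this[of "n div (l - m)" "n mod (l - m)"]
    have "\<tau> n = \<tau> (n mod (l - m)) + 2 * pi * of_int (n div (l - m))"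
      unfolding div_mult_mod_eq .
    then show ?thesis by (simp add: period)
  qed

  have "local_singular_points f = {f (\<tau> n) | n. True}"
    unfolding local_singular_points_def singular_iff by blast
  also have "\<dots> = {f (\<tau> k) | k. 0 \<le> k \<and> k \<le> l - m - 1}"
  proof -
    have "0 \<le> n mod (l - m) \<and> n mod (l - m) \<le> l - m - 1" for n
      using \<open>l > m\<close> pos_mod_bound[of "l - m" n] by simp
    then show ?thesis using reduce by blast
  qed
  finally show ?thesis .
qed

end
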